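(* In the Bernoulli setting with $\mathscr{A}_{\mathrm{sing}},\mathscr{A}_{\mathrm{inv}}$ both nonempty, let $\eta$ be the unique $\mathcal{Q}$-stationary probability measure on $\mathbb{P}^1$. Then $p\times\eta$ is $\bar{\mathcal{Q}}$-stationary and $\bar{\mathcal{Q}}$ is uniformly ergodic: there exist constants $c>0$, $C<\infty$ such that $$\Big\|\bar{\mathcal{Q}}^n\varphi-\int\varphi\,d(p\times\eta)\Big\|_\infty\le Ce^{-cn}\|\varphi\|_\infty\quad\forall n\in\mathbb{N},\ \forall\varphi\in L^\infty(\mathscr{A}\times\mathbb{P}^1).$$ In particular $p\times\eta$ is the unique $\bar{\mathcal{Q}}$-stationary measure.
   Context: $\mathscr{A}=\{1,\dots,k\}=\mathscr{A}_{\mathrm{sing}}\sqcup\mathscr{A}_{\mathrm{inv}}$ both nonempty, $p$ a probability vector with all $p_i>0$, $\underline A=(A_i)$ with $\mathrm{rank}A_i=1$ for $i\in\mathscr{A}_{\mathrm{sing}}$ and $A_i$ invertible for $i\in\mathscr{A}_{\mathrm{inv}}$. Projective action: $\hat A\hat v=\widehat{Av}$ (invertible), constant map to $\widehat{\mathrm{Range}A}$ (rank one). $\mathcal{Q}\psi(\hat v)=\sum_ip_i\psi(\hat A_i\hat v)$ on $L^\infty(\mathbb{P}^1)$; $\bar{\mathcal{Q}}\varphi(j,\hat v)=\sum_ip_i\varphi(i,\hat A_j\hat v)$ on $L^\infty(\mathscr{A}\times\mathbb{P}^1)$. A measure $\nu$ is stationary for an operator $T$ if $\int T\varphi\,d\nu=\int\varphi\,d\nu$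 for all bounded measurable $\varphi$. *)

theory Defs
  imports "HOL-Analysis.Analysis" "HOL-Probability.Probability"
begin

text \<open>The real projective line, realised as the set of unit vectors of R^2 in the
  "upper half" (one representative per line through the origin).\<close>

definition P1 :: "(real^2) set" where
  "P1 = {v. norm v = 1 \<and> (v$2 > 0 \<or> (v$2 = 0 \<and> v$1 > 0))}"

text \<open>The point of P1 (line) spanned by a nonzero vector.\<close>
definition proj :: "real^2 \<Rightarrow> real^2" where
  "proj v = (let u = v /\<^sub>R norm v in if u \<in> P1 then u else - u)"

text \<open>Measurable structure of P1: Borel sets of the quotient (subspace of the sphere).\<close>
definition P1M :: "(real^2) measure" where
  "P1M = restrict_space borel P1"

text \<open>Projective action: for invertible A, the induced map on lines; otherwise
  (rank one) the constant map onto the line Range A.\<close>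
definition pact :: "real^2^2 \<Rightarrow> real^2 \<Rightarrow> real^2" where
  "pact A x = (if invertible A then proj (A *v x)
               else proj (SOME w. w \<in> range ((*v) A) \<and> w \<noteq> 0))"

definition Qop :: "nat \<Rightarrow> (nat \<Rightarrow> real) \<Rightarrow> (nat \<Rightarrow> real^2^2) \<Rightarrow>
    (real^2 \<Rightarrow> real) \<Rightarrow> real^2 \<Rightarrow> real" where
  "Qop k p A \<psi> x = (\<Sum>i\<in>{1..k}. p i * \<psi> (pact (A i) x))"

definition Qbar :: "nat \<Rightarrow> (nat \<Rightarrow> real) \<Rightarrow> (nat \<Rightarrow> real^2^2) \<Rightarrow>
    (nat \<times> (real^2) \<Rightarrow> real) \<Rightarrow> nat \<times> (real^2) \<Rightarrow> real" where
  "Qbar k p A \<phi> z = (\<Sum>i\<in>{1..k}. p i * \<phi> (i, pact (A (fst z)) (snd z)))"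

text \<open>Measurable space of the alphabet times P1.\<close>
definition AP1M :: "nat \<Rightarrow> (nat \<times> (real^2)) measure" where
  "AP1M k = count_space {1..k} \<Otimes>\<^sub>M P1M"

text \<open>The measure p on the alphabet.\<close>
definition pmeas :: "nat \<Rightarrow> (nat \<Rightarrow> real) \<Rightarrow> nat measure" where
  "pmeas k p = density (count_space {1..k}) (\<lambda>i. ennreal (p i))"

text \<open>nu is T-stationary on the measurable space M: integrals of T phi and phi agree
  for every bounded measurable phi.\<close>
definition stationary :: "'a measure \<Rightarrow> (('a \<Rightarrow> real) \<Rightarrow> 'a \<Rightarrow> real) \<Rightarrow> 'a measure \<Rightarrow> bool" where
  "stationary M T \<nu> \<longleftrightarrow> sets \<nu> = sets M \<and>
     (\<forall>\<phi> \<in> borel_measurable M. bounded (\<phi> ` space M) \<longrightarrow>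
        (\<integral>x. T \<phi> x \<partial>\<nu>) = (\<integral>x. \<phi> x \<partial>\<nu>))"

text \<open>Sup norm of a bounded function on the space of M.\<close>
definition supnorm :: "'a measure \<Rightarrow> ('a \<Rightarrow> real) \<Rightarrow> real" where
  "supnorm M \<phi> = (SUP x\<in>space M. \<bar>\<phi> x\<bar>)"

end

theory Submission
  imports Defs
begin

text \<open>A rank-one letter maps all of \<open>P1\<close> to a single point, so after such a letter the chain
  forgets its projective coordinate. Writing \<open>q < 1\<close> for the total weight of the invertible
  letters, the oscillation of \<open>Qbar\<^sup>n \<phi>\<close> is therefore at most \<open>2 \<parallel>\<phi>\<parallel> q ^ (n - 1)\<close>.
  Integrating against a stationary probability measure, whose integral of \<open>Qbar\<^sup>n \<phi>\<close> does not
  depend on \<open>n\<close>, turns this into uniform exponential convergence towards \<open>\<integral>\<phi>\<close> and forces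
  uniqueness. The product \<open>p \<times> \<eta>\<close> is stationary since \<open>Qbar\<close> draws the next letter
  independently with law \<open>p\<close> and \<open>\<eta>\<close> is \<open>Qop\<close>-stationary.\<close>

lemma abs_convex_sum_le:
  fixes f w :: "'a \<Rightarrow> real"
  assumes "finite I" "\<And>i. i \<in> I \<Longrightarrow> 0 \<le> w i" "sum w I = 1" "\<And>i. i \<in> I \<Longrightarrow> \<bar>f i\<bar> \<le> D"
  shows "\<bar>\<Sum>i\<in>I. w i * f i\<bar> \<le> D"
proof -
  have "\<bar>\<Sum>i\<in>I. w i * f i\<bar> \<le> (\<Sum>i\<in>I. w i * D)"
    using assms(2,4) by (intro order.trans[OF sum_abs] sum_mono) (simp add: abs_mult mult_left_mono)
  also have "\<dots> = D"
    using assms(3) by (simp flip: sum_distrib_right)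
  finally show ?thesis .
qed

lemma abs_integral_minus_const_le:
  fixes g :: "'a \<Rightarrow> real"
  assumes "prob_space M"
    and "g \<in> borel_measurable M" "\<And>x. x \<in> space M \<Longrightarrow> \<bar>g x - m\<bar> \<le> D"
  shows "\<bar>(\<integral>x. g x \<partial>M) - m\<bar> \<le> D"
proof -
  interpret prob_space M by fact
  have bounds: "m - D \<le> g x" "g x \<le> m + D" if "x \<in> space M" for x
    using assms(3)[OF that] by linarith+
  have "integrable M g"
    using assms(2) bounds
    by (intro integrable_const_bound[where B="\<bar>m\<bar> + D"] AE_I2) fastforce+
  then have "(\<integral>x. m - D \<partial>M) \<le> (\<integral>x. g x \<partial>M)" "(\<integral>x. g x \<partial>M) \<le> (\<integral>x. m + D \<partial>M)"
    using bounds by (intro integral_mono; simp)+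
  then show ?thesis
    by (simp add: prob_space.prob_space[OF assms(1)])
qed

lemma abs_le_supnorm:
  fixes \<phi> :: "'a \<Rightarrow> real"
  assumes "bounded (\<phi> ` space M)" "z \<in> space M"
  shows "\<bar>\<phi> z\<bar> \<le> supnorm M \<phi>"
proof -
  obtain a where "\<And>x. x \<in> space M \<Longrightarrow> \<bar>\<phi> x\<bar> \<le> a"
    using assms(1) by (auto simp: bounded_real)
  then have "bdd_above ((\<lambda>x. \<bar>\<phi> x\<bar>) ` space M)"
    by (intro bdd_aboveI2)
  then show ?thesis
    unfolding supnorm_def using assms(2) by (rule cSUP_upper2) simp
qed

lemma funpow_preserves_bounded_measurable:
  fixes T :: "('a \<Rightarrow> real) \<Rightarrow> 'a \<Rightarrow> real"
  assumes "\<phi> \<in> borel_measurable M" "bounded (\<phi> ` space M)"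
    and preserve: "\<And>\<psi>. \<psi> \<in> borel_measurable M \<Longrightarrow> bounded (\<psi> ` space M) \<Longrightarrow>
       T \<psi> \<in> borel_measurable M \<and> bounded (T \<psi> ` space M)"
  shows "(T ^^ n) \<phi> \<in> borel_measurable M \<and> bounded ((T ^^ n) \<phi> ` space M)"
proof (induction n)
  case (Suc n)
  then show ?case
    using preserve[of "(T ^^ n) \<phi>"] by simp
qed (use assms in simp)

lemma stationary_funpow:
  assumes st: "stationary M T \<nu>" and \<phi>: "\<phi> \<in> borel_measurable M" "bounded (\<phi> ` space M)"
    and preserve: "\<And>\<psi>. \<psi> \<in> borel_measurable M \<Longrightarrow> bounded (\<psi> ` space M) \<Longrightarrow>
       T \<psi> \<in> borel_measurable M \<and> bounded (T \<psi> ` space M)"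
  shows "(\<integral>x. (T ^^ n) \<phi> x \<partial>\<nu>) = (\<integral>x. \<phi> x \<partial>\<nu>)"
proof (induction n)
  case (Suc n)
  with st funpow_preserves_bounded_measurable[OF \<phi> preserve, where n=n] show ?case
    by (simp add: stationary_def)
qed simp

lemma stationary_unique_of_uniform_convergence:
  assumes \<nu>: "prob_space \<nu>" "stationary M T \<nu>"
    and \<mu>: "prob_space \<mu>" "sets \<mu> = sets M"
    and preserve: "\<And>\<psi>. \<psi> \<in> borel_measurable M \<Longrightarrow> bounded (\<psi> ` space M) \<Longrightarrow>
       T \<psi> \<in> borel_measurable M \<and> bounded (T \<psi> ` space M)"
    and "c > 0"
    and conv: "\<forall>n::nat. \<forall>\<phi> \<in> borel_measurable M. bounded (\<phi> ` space M) \<longrightarrow>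
          (\<forall>z \<in> space M. \<bar>(T ^^ n) \<phi> z - (\<integral>w. \<phi> w \<partial>\<mu>)\<bar> \<le> C * exp (- c * real n) * supnorm M \<phi>)"
  shows "\<nu> = \<mu>"
proof (rule measure_eqI)
  interpret N: prob_space \<nu> by (rule \<nu>(1))
  interpret MU: prob_space \<mu> by (rule \<mu>(1))
  have sets_\<nu>: "sets \<nu> = sets M"
    using \<nu>(2) by (simp add: stationary_def)
  then show "sets \<nu> = sets \<mu>"
    using \<mu>(2) by simp
  fix X assume "X \<in> sets \<nu>"
  then have X: "X \<in> sets M" "X \<subseteq> space M" "X \<subseteq> space \<nu>" "X \<subseteq> space \<mu>"
    using sets.sets_into_space sets_\<nu> \<mu>(2) by (auto dest: sets_eq_imp_space_eq)
  define \<phi> :: "_ \<Rightarrow> real" where "\<phi> = indicator X"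
  have \<phi>: "\<phi> \<in> borel_measurable M" "bounded (\<phi> ` space M)"
    using X(1) by (auto simp: \<phi>_def bounded_real intro: exI[of _ 1])
  define s where "s = supnorm M \<phi>"
  have "\<bar>(\<integral>x. \<phi> x \<partial>\<nu>) - (\<integral>w. \<phi> w \<partial>\<mu>)\<bar> \<le> C * exp (- c * real n) * s" for n
  proof -
    have "\<bar>(\<integral>x. (T ^^ n) \<phi> x \<partial>\<nu>) - (\<integral>w. \<phi> w \<partial>\<mu>)\<bar> \<le> C * exp (- c * real n) * s"
    proof (rule abs_integral_minus_const_le[OF \<nu>(1)])
      show "(T ^^ n) \<phi> \<in> borel_measurable \<nu>"
        using funpow_preserves_bounded_measurable[OF \<phi> preserve] sets_\<nu>
        by (simp cong: measurable_cong_sets)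
    qed (use conv \<phi> sets_eq_imp_space_eq[OF sets_\<nu>] in \<open>auto simp: s_def\<close>)
    then show ?thesis
      using stationary_funpow[OF \<nu>(2) \<phi> preserve] by simp
  qed
  moreover have "(\<lambda>n. C * exp (- c * real n) * s) \<longlonglongrightarrow> C * 0 * s"
  proof (intro tendsto_intros)
    have "(\<lambda>n. exp (- c) ^ n) \<longlonglongrightarrow> 0"
      using \<open>c > 0\<close> by (intro LIMSEQ_power_zero) auto
    then show "(\<lambda>n. exp (- c * real n)) \<longlonglongrightarrow> 0"
      by (simp add: exp_of_nat_mult[symmetric] mult.commute)
  qed
  ultimately have "\<bar>(\<integral>x. \<phi> x \<partial>\<nu>) - (\<integral>w. \<phi> w \<partial>\<mu>)\<bar> \<le> 0"
    by (intro LIMSEQ_le_const) auto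
  then have "measure \<nu> X = measure \<mu> X"
    using X by (simp add: \<phi>_def Int_absorb2)
  then show "emeasure \<nu> X = emeasure \<mu> X"
    by (simp add: N.emeasure_eq_measure MU.emeasure_eq_measure)
qed

section \<open>The projective action\<close>

lemma space_P1M [simp]: "space P1M = P1"
  by (simp add: P1M_def space_restrict_space)

lemma zero_notin_P1: "v \<in> P1 \<Longrightarrow> v \<noteq> 0"
  by (auto simp: P1_def)

lemma proj_in_P1:
  assumes "v \<noteq> 0" shows "proj v \<in> P1"
proof -
  define u where "u = v /\<^sub>R norm v"
  have "norm u = 1" "u \<noteq> 0"
    using assms by (auto simp: u_def)
  then have "u \<in> P1 \<or> - u \<in> P1"
    by (auto simp: P1_def vec_eq_iff forall_2)
  then show ?thesis
    unfolding proj_def Let_def u_def[symmetric] by auto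
qed

lemma P1_sets: "P1 \<in> sets borel"
proof -
  have "P1 = {v::real^2. norm v = 1} \<inter> ({v. v$2 > 0} \<union> ({v. v$2 = 0} \<inter> {v. v$1 > 0}))"
    by (auto simp: P1_def)
  also have "\<dots> \<in> sets borel"
    by measurable
  finally show ?thesis .
qed

lemma proj_measurable: "proj \<in> borel_measurable borel"
proof -
  have "proj = (\<lambda>v. if v /\<^sub>R norm v \<in> P1 then v /\<^sub>R norm v else - (v /\<^sub>R norm v))"
    by (auto simp: proj_def Let_def fun_eq_iff)
  also have "\<dots> \<in> borel_measurable borel"
    using P1_sets by measurable
  finally show ?thesis .
qed

lemma rank_one_not_invertible:
  assumes "rank (B::real^2^2) = 1" shows "\<not> invertible B"
proof
  assume "invertible B"
  then have "inj ((*v) B)"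
    using matrix_left_invertible_injective invertible_def by blast
  then have "rank B = 2"
    using full_rank_injective[of B] by simp
  with assms show False
    by simp
qed

lemma rank_one_range_nonzero:
  assumes "rank (B::real^2^2) = 1" shows "\<exists>w. w \<in> range ((*v) B) \<and> w \<noteq> 0"
proof (rule ccontr)
  assume "\<not> ?thesis"
  then have "B = 0"
    by (subst matrix_eq) auto
  with assms show False
    by simp
qed

lemma pact_singular_const: "\<not> invertible B \<Longrightarrow> pact B x = pact B y"
  by (simp add: pact_def)

lemma pact_in_P1:
  assumes "invertible B \<or> rank B = 1" "v \<in> P1" shows "pact B v \<in> P1"
  using assms(1)
proof
  assume "invertible B"
  then have "B *v v \<noteq> 0"
    using zero_notin_P1[OF assms(2)]
    by (metis invertible_def matrix_vector_mul_assoc matrix_vector_mul_lid matrix_vector_mult_0_right)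
  with \<open>invertible B\<close> show ?thesis
    by (simp add: pact_def proj_in_P1)
next
  assume "rank B = 1"
  then have "(SOME w. w \<in> range ((*v) B) \<and> w \<noteq> 0) \<noteq> 0"
    by (metis (mono_tags, lifting) rank_one_range_nonzero someI_ex)
  with \<open>rank B = 1\<close> show ?thesis
    by (simp add: pact_def proj_in_P1 rank_one_not_invertible)
qed

lemma pact_measurable_borel: "pact B \<in> borel_measurable borel"
proof (cases "invertible B")
  case True
  then have "pact B = (\<lambda>x. proj (B *v x))"
    by (simp add: pact_def fun_eq_iff)
  also have "\<dots> \<in> borel_measurable borel"
    by (intro measurable_compose[OF _ proj_measurable] borel_measurable_continuous_onI
          linear_continuous_on matrix_vector_mul_bounded_linear)
  finally show ?thesis .
next
  case False
  then have "pact B = (\<lambda>_. pact B 0)"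
    using pact_singular_const by auto
  then show ?thesis
    by (metis measurable_const space_borel UNIV_I)
qed

lemma pact_measurable:
  assumes "invertible B \<or> rank B = 1" shows "pact B \<in> P1M \<rightarrow>\<^sub>M P1M"
  unfolding P1M_def
  by (rule measurable_restrict_space3[OF pact_measurable_borel]) (use pact_in_P1[OF assms] in auto)

section \<open>The Bernoulli setting\<close>

locale bernoulli_setting =
  fixes k :: nat and p :: "nat \<Rightarrow> real" and A :: "nat \<Rightarrow> real^2^2"
    and Asing Ainv :: "nat set" and \<eta> :: "(real^2) measure"
  assumes part: "Asing \<union> Ainv = {1..k}" "Asing \<inter> Ainv = {}"
    and ne: "Asing \<noteq> {}" "Ainv \<noteq> {}"
    and ppos: "\<And>i. i \<in> {1..k} \<Longrightarrow> p i > 0"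
    and psum: "(\<Sum>i\<in>{1..k}. p i) = 1"
    and sing: "\<And>i. i \<in> Asing \<Longrightarrow> rank (A i) = 1"
    and inv: "\<And>i. i \<in> Ainv \<Longrightarrow> invertible (A i)"
    and eta_prob: "prob_space \<eta>"
    and eta_stat: "stationary P1M (Qop k p A) \<eta>"
begin

abbreviation "S \<equiv> {1..k} \<times> P1"
abbreviation "M \<equiv> AP1M k"
abbreviation "T \<equiv> Qbar k p A"
abbreviation "\<mu> \<equiv> pmeas k p \<Otimes>\<^sub>M \<eta>"

definition q :: real where "q = (\<Sum>i\<in>Ainv. p i)"

definition avg :: "(nat \<times> (real^2) \<Rightarrow> real) \<Rightarrow> real^2 \<Rightarrow> real" where
  "avg \<psi> w = (\<Sum>i\<in>{1..k}. p i * \<psi> (i, w))"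

lemma letter_admissible: "j \<in> {1..k} \<Longrightarrow> invertible (A j) \<or> rank (A j) = 1"
  using part sing inv by blast

lemma pact_letter_in_P1: "j \<in> {1..k} \<Longrightarrow> v \<in> P1 \<Longrightarrow> pact (A j) v \<in> P1"
  by (rule pact_in_P1[OF letter_admissible])

lemma Ainv_subset: "Ainv \<subseteq> {1..k}"
  using part(1) by blast

lemma finite_Asing_Ainv: "finite Asing" "finite Ainv"
  using part(1) by (metis finite_Un finite_atLeastAtMost)+

lemma abs_sum_p_le: "(\<And>i. i \<in> {1..k} \<Longrightarrow> \<bar>f i\<bar> \<le> D) \<Longrightarrow> \<bar>\<Sum>i\<in>{1..k}. p i * f i\<bar> \<le> D"
  using ppos psum by (intro abs_convex_sum_le) (auto intro: less_imp_le)

lemma q_pos: "0 < q" and q_less_1: "q < 1"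
proof -
  have pos: "0 < p i" if "i \<in> Asing \<union> Ainv" for i
    using ppos part(1) that by blast
  have "0 < (\<Sum>i\<in>Asing. p i)"
    using finite_Asing_Ainv ne pos by (intro sum_pos) auto
  moreover show "0 < q"
    unfolding q_def using finite_Asing_Ainv ne pos by (intro sum_pos) auto
  moreover have "(\<Sum>i\<in>Asing. p i) + q = 1"
    unfolding q_def psum[symmetric] part(1)[symmetric]
    by (rule sum.union_disjoint[symmetric, OF finite_Asing_Ainv part(2)])
  ultimately show "q < 1"
    by linarith
qed

lemma space_M [simp]: "space M = S"
  by (simp add: AP1M_def space_pair_measure)

lemma sets_eta: "sets \<eta> = sets P1M"
  using eta_stat by (simp add: stationary_def)

lemma prob_space_pmeas: "prob_space (pmeas k p)"
proof (rule prob_spaceI)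
  have "emeasure (pmeas k p) (space (pmeas k p)) = (\<Sum>i\<in>{1..k}. ennreal (p i))"
    by (simp add: pmeas_def emeasure_density nn_integral_count_space_finite)
  also have "\<dots> = 1"
    using ppos psum by (subst sum_ennreal) (auto intro: less_imp_le)
  finally show "emeasure (pmeas k p) (space (pmeas k p)) = 1" .
qed

lemma prob_space_mu: "prob_space \<mu>"
  by (rule prob_space_pair[OF prob_space_pmeas eta_prob])

lemma sets_mu: "sets \<mu> = sets M"
  unfolding AP1M_def by (rule sets_pair_measure_cong) (simp_all add: pmeas_def sets_eta)

subsection \<open>\<open>Qbar\<close> preserves bounded measurable functions\<close>

lemma slice_measurable:
  "\<phi> \<in> borel_measurable M \<Longrightarrow> i \<in> {1..k} \<Longrightarrow> (\<lambda>v. \<phi> (i, v)) \<in> borel_measurable P1M"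
  unfolding AP1M_def by (rule measurable_compose[OF measurable_Pair1']) simp_all

lemma slice_pact_measurable:
  "\<phi> \<in> borel_measurable M \<Longrightarrow> i \<in> {1..k} \<Longrightarrow> j \<in> {1..k} \<Longrightarrow>
     (\<lambda>v. \<phi> (i, pact (A j) v)) \<in> borel_measurable P1M"
  by (rule measurable_compose[OF pact_measurable[OF letter_admissible] slice_measurable])

lemma Qbar_measurable:
  assumes "\<phi> \<in> borel_measurable M" shows "T \<phi> \<in> borel_measurable M"
  unfolding AP1M_def
proof (rule measurable_pair_measure_countable1)
  fix j assume "j \<in> {1..k}"
  then show "(\<lambda>v. T \<phi> (j, v)) \<in> borel_measurable P1M"
    unfolding Qbar_def fst_conv snd_conv
    using slice_pact_measurable[OF assms] by (intro borel_measurable_sum borel_measurable_times measurable_const) auto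
qed simp

lemma Qbar_abs_le:
  assumes "\<And>z. z \<in> S \<Longrightarrow> \<bar>\<phi> z\<bar> \<le> B" "z \<in> S"
  shows "\<bar>T \<phi> z\<bar> \<le> B"
proof -
  obtain j v where "z = (j, v)" "j \<in> {1..k}" "v \<in> P1"
    using assms(2) by blast
  then show ?thesis
    unfolding Qbar_def using assms(1) pact_letter_in_P1 by (intro abs_sum_p_le) auto
qed

lemma Qbar_preserves_bounded_measurable:
  assumes "\<phi> \<in> borel_measurable M" "bounded (\<phi> ` space M)"
  shows "T \<phi> \<in> borel_measurable M \<and> bounded (T \<phi> ` space M)"
proof -
  obtain B where "\<And>z. z \<in> S \<Longrightarrow> \<bar>\<phi> z\<bar> \<le> B"
    using assms(2) by (auto simp: bounded_real)
  then have "bounded (T \<phi> ` space M)"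
    unfolding bounded_real using Qbar_abs_le by (intro exI[of _ B]) simp
  with Qbar_measurable[OF assms(1)] show ?thesis
    by simp
qed

subsection \<open>Stationarity of \<open>p \<times> \<eta>\<close>\<close>

lemma integrable_eta_bounded:
  fixes B :: real
  assumes "g \<in> borel_measurable P1M" "\<And>v. v \<in> P1 \<Longrightarrow> \<bar>g v\<bar> \<le> B"
  shows "integrable \<eta> g"
proof -
  interpret prob_space \<eta> by (rule eta_prob)
  show ?thesis
    using assms sets_eta sets_eq_imp_space_eq[OF sets_eta]
    by (intro integrable_const_bound[where B=B] AE_I2) (auto cong: measurable_cong_sets)
qed

lemma integral_eta_sum:
  assumes "\<And>j. j \<in> {1..k} \<Longrightarrow> g j \<in> borel_measurable P1M"
    "\<And>j v. j \<in> {1..k} \<Longrightarrow> v \<in> P1 \<Longrightarrow> \<bar>g j v\<bar> \<le> B"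
  shows "(\<integral>v. (\<Sum>j\<in>{1..k}. p j * g j v) \<partial>\<eta>) = (\<Sum>j\<in>{1..k}. p j * (\<integral>v. g j v \<partial>\<eta>))"
proof -
  have "(\<integral>v. (\<Sum>j\<in>{1..k}. p j * g j v) \<partial>\<eta>) = (\<Sum>j\<in>{1..k}. (\<integral>v. p j * g j v \<partial>\<eta>))"
    using assms by (intro Bochner_Integration.integral_sum) (auto intro!: integrable_mult_right integrable_eta_bounded)
  then show ?thesis
    by simp
qed

lemma integral_mu:
  assumes f: "f \<in> borel_measurable M" and "\<And>z. z \<in> S \<Longrightarrow> \<bar>f z\<bar> \<le> B"
  shows "(\<integral>z. f z \<partial>\<mu>) = (\<Sum>i\<in>{1..k}. p i * (\<integral>v. f (i, v) \<partial>\<eta>))"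
proof -
  interpret P: prob_space "pmeas k p" by (rule prob_space_pmeas)
  interpret E: prob_space \<eta> by (rule eta_prob)
  interpret pair_sigma_finite "pmeas k p" \<eta> by unfold_locales
  interpret MU: prob_space \<mu> by (rule prob_space_mu)
  have "integrable \<mu> f"
    using assms sets_mu sets_eq_imp_space_eq[OF sets_mu]
    by (intro MU.integrable_const_bound[where B=B] AE_I2) (auto cong: measurable_cong_sets)
  then have "(\<integral>z. f z \<partial>\<mu>) = (\<integral>i. (\<integral>v. f (i, v) \<partial>\<eta>) \<partial>pmeas k p)"
    by (simp add: integral_fst')
  also have "\<dots> = (\<integral>i. p i *\<^sub>R (\<integral>v. f (i, v) \<partial>\<eta>) \<partial>count_space {1..k})"
    unfolding pmeas_def
    by (rule integral_density) (use ppos in \<open>auto intro!: AE_I2 less_imp_le\<close>)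
  also have "\<dots> = (\<Sum>i\<in>{1..k}. p i * (\<integral>v. f (i, v) \<partial>\<eta>))"
    by (simp add: lebesgue_integral_count_space_finite)
  finally show ?thesis .
qed

lemma stationary_mu: "stationary M T \<mu>"
  unfolding stationary_def
proof (intro conjI ballI impI sets_mu)
  fix \<phi> :: "nat \<times> (real^2) \<Rightarrow> real"
  assume \<phi>: "\<phi> \<in> borel_measurable M" "bounded (\<phi> ` space M)"
  then obtain B where B: "\<And>z. z \<in> S \<Longrightarrow> \<bar>\<phi> z\<bar> \<le> B"
    by (auto simp: bounded_real)
  define I where "I i j = (\<integral>v. \<phi> (i, pact (A j) v) \<partial>\<eta>)" for i j
  have slice_le: "\<bar>\<phi> (i, pact (A j) v)\<bar> \<le> B" if "i \<in> {1..k}" "j \<in> {1..k}" "v \<in> P1" for i j v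
    using B pact_letter_in_P1 that by auto
  have Qop_slice: "(\<Sum>j\<in>{1..k}. p j * I i j) = (\<integral>v. \<phi> (i, v) \<partial>\<eta>)" if i: "i \<in> {1..k}" for i
  proof -
    have "(\<Sum>j\<in>{1..k}. p j * I i j) = (\<integral>v. Qop k p A (\<lambda>v. \<phi> (i, v)) v \<partial>\<eta>)"
      unfolding Qop_def I_def
      by (rule integral_eta_sum[where B=B, symmetric]) (use slice_pact_measurable[OF \<phi>(1)] slice_le i in auto)
    also have "\<dots> = (\<integral>v. \<phi> (i, v) \<partial>\<eta>)"
      using eta_stat slice_measurable[OF \<phi>(1) i] B i
      by (auto simp: stationary_def bounded_real intro!: exI[of _ B])
    finally show ?thesis .
  qed
  have "(\<integral>z. T \<phi> z \<partial>\<mu>) = (\<Sum>j\<in>{1..k}. p j * (\<integral>v. T \<phi> (j, v) \<partial>\<eta>))"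
    by (rule integral_mu[OF Qbar_measurable[OF \<phi>(1)] Qbar_abs_le[OF B]])
  also have "\<dots> = (\<Sum>j\<in>{1..k}. p j * (\<Sum>i\<in>{1..k}. p i * I i j))"
    unfolding Qbar_def fst_conv snd_conv I_def
    using slice_pact_measurable[OF \<phi>(1)] slice_le
    by (intro sum.cong refl arg_cong[where f="(*) (p _)"] integral_eta_sum[where B=B]) auto
  also have "\<dots> = (\<Sum>i\<in>{1..k}. p i * (\<Sum>j\<in>{1..k}. p j * I i j))"
    by (simp add: sum_distrib_left, subst sum.swap, simp add: mult.left_commute)
  also have "\<dots> = (\<Sum>i\<in>{1..k}. p i * (\<integral>v. \<phi> (i, v) \<partial>\<eta>))"
    using Qop_slice by simp
  also have "\<dots> = (\<integral>z. \<phi> z \<partial>\<mu>)"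
    by (rule integral_mu[OF \<phi>(1) B, symmetric])
  finally show "(\<integral>z. T \<phi> z \<partial>\<mu>) = (\<integral>z. \<phi> z \<partial>\<mu>)" .
qed

subsection \<open>Contraction of the oscillation\<close>

lemma Qbar_eq_avg: "T \<psi> (j, v) = avg \<psi> (pact (A j) v)"
  by (simp add: Qbar_def avg_def)

lemma avg_oscillation_funpow:
  assumes B: "\<And>z. z \<in> S \<Longrightarrow> \<bar>\<phi> z\<bar> \<le> B"
  shows "w \<in> P1 \<Longrightarrow> w' \<in> P1 \<Longrightarrow> \<bar>avg ((T ^^ n) \<phi>) w - avg ((T ^^ n) \<phi>) w'\<bar> \<le> 2 * B * q ^ n"
proof (induction n arbitrary: w w')
  case 0
  have "\<bar>\<Sum>i\<in>{1..k}. p i * (\<phi> (i, w) - \<phi> (i, w'))\<bar> \<le> 2 * B"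
  proof (rule abs_sum_p_le)
    fix i assume "i \<in> {1..k}"
    then show "\<bar>\<phi> (i, w) - \<phi> (i, w')\<bar> \<le> 2 * B"
      using B[of "(i, w)"] B[of "(i, w')"] 0 by auto
  qed
  then show ?case
    by (simp add: avg_def sum_subtractf right_diff_distrib)
next
  case (Suc n)
  define d where "d i = avg ((T ^^ n) \<phi>) (pact (A i) w) - avg ((T ^^ n) \<phi>) (pact (A i) w')" for i
  have "avg ((T ^^ Suc n) \<phi>) w - avg ((T ^^ Suc n) \<phi>) w' = (\<Sum>i\<in>{1..k}. p i * d i)"
    by (simp add: avg_def Qbar_eq_avg d_def sum_subtractf right_diff_distrib)
  also have "\<dots> = (\<Sum>i\<in>Ainv. p i * d i)"
    \<comment> \<open>a rank-one letter sends \<open>w\<close> and \<open>w'\<close> to the same point\<close>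
    unfolding part(1)[symmetric] sum.union_disjoint[OF finite_Asing_Ainv part(2)]
    using sing by (simp add: d_def pact_singular_const[OF rank_one_not_invertible, of _ w w'])
  finally have "\<bar>avg ((T ^^ Suc n) \<phi>) w - avg ((T ^^ Suc n) \<phi>) w'\<bar> \<le> (\<Sum>i\<in>Ainv. \<bar>p i * d i\<bar>)"
    by (simp only: sum_abs)
  also have "\<dots> = (\<Sum>i\<in>Ainv. p i * \<bar>d i\<bar>)"
  proof (rule sum.cong[OF refl])
    fix i assume "i \<in> Ainv"
    then have "0 < p i"
      using Ainv_subset ppos by blast
    then show "\<bar>p i * d i\<bar> = p i * \<bar>d i\<bar>"
      by (simp add: abs_mult)
  qed
  also have "\<dots> \<le> (\<Sum>i\<in>Ainv. p i * (2 * B * q ^ n))"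
  proof (rule sum_mono)
    fix i assume "i \<in> Ainv"
    then have "i \<in> {1..k}" "0 < p i"
      using Ainv_subset ppos by auto
    then show "p i * \<bar>d i\<bar> \<le> p i * (2 * B * q ^ n)"
      unfolding d_def using Suc.prems
      by (intro mult_left_mono Suc.IH pact_letter_in_P1) simp_all
  qed
  also have "\<dots> = 2 * B * q ^ Suc n"
    by (simp add: q_def flip: sum_distrib_right)
  finally show ?case .
qed

lemma Qbar_funpow_oscillation:
  assumes B: "\<And>z. z \<in> S \<Longrightarrow> \<bar>\<phi> z\<bar> \<le> B" and z: "z \<in> S" "z' \<in> S"
  shows "\<bar>(T ^^ n) \<phi> z - (T ^^ n) \<phi> z'\<bar> \<le> 2 * B * q ^ n / q"
proof (cases n)
  case 0
  have "0 \<le> B"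
    using B[OF z(1)] by linarith
  then have "2 * B \<le> 2 * B / q"
    using q_pos q_less_1 by (simp add: le_divide_eq mult_left_le)
  moreover have "\<bar>\<phi> z - \<phi> z'\<bar> \<le> 2 * B"
    using B[OF z(1)] B[OF z(2)] by linarith
  ultimately show ?thesis
    using 0 by simp
next
  case (Suc m)
  obtain j v j' v' where zz: "z = (j, v)" "z' = (j', v')" "j \<in> {1..k}" "v \<in> P1" "j' \<in> {1..k}" "v' \<in> P1"
    using z by auto
  have "\<bar>(T ^^ n) \<phi> z - (T ^^ n) \<phi> z'\<bar> \<le> 2 * B * q ^ m"
    unfolding zz(1,2) Suc funpow.simps o_apply Qbar_eq_avg
    using zz(3-) by (intro avg_oscillation_funpow[OF B] pact_letter_in_P1)
  also have "\<dots> = 2 * B * q ^ n / q"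
    using q_pos by (simp add: Suc)
  finally show ?thesis .
qed

lemma Qbar_funpow_exponential_convergence:
  assumes \<phi>: "\<phi> \<in> borel_measurable M" "bounded (\<phi> ` space M)" and z: "z \<in> S"
  shows "\<bar>(T ^^ n) \<phi> z - (\<integral>w. \<phi> w \<partial>\<mu>)\<bar> \<le> 2 / q * exp (- (- ln q) * real n) * supnorm M \<phi>"
proof -
  have B: "\<And>z. z \<in> S \<Longrightarrow> \<bar>\<phi> z\<bar> \<le> supnorm M \<phi>"
    using abs_le_supnorm[OF \<phi>(2)] by simp
  have "\<bar>(\<integral>w. (T ^^ n) \<phi> w \<partial>\<mu>) - (T ^^ n) \<phi> z\<bar> \<le> 2 * supnorm M \<phi> * q ^ n / q"
  proof (rule abs_integral_minus_const_le[OF prob_space_mu])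
    show "(T ^^ n) \<phi> \<in> borel_measurable \<mu>"
      using \<phi>(1) Qbar_measurable sets_mu by (induction n) (auto cong: measurable_cong_sets)
  qed (use Qbar_funpow_oscillation[OF B _ z] sets_eq_imp_space_eq[OF sets_mu] in simp)
  moreover have "exp (- (- ln q) * real n) = exp (ln q) ^ n"
    by (simp add: exp_of_nat_mult[symmetric] mult.commute)
  then have "exp (- (- ln q) * real n) = q ^ n"
    using q_pos by simp
  ultimately show ?thesis
    using stationary_funpow[OF stationary_mu \<phi> Qbar_preserves_bounded_measurable]
    by (simp add: abs_minus_commute mult_ac)
qed

end

theorem corollary3p1:
  fixes k :: nat and p :: "nat \<Rightarrow> real" and A :: "nat \<Rightarrow> real^2^2"
    and Asing Ainv :: "nat set" and \<eta> :: "(real^2) measure"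
  assumes part: "Asing \<union> Ainv = {1..k}" "Asing \<inter> Ainv = {}"
    and ne: "Asing \<noteq> {}" "Ainv \<noteq> {}"
    and ppos: "\<And>i. i \<in> {1..k} \<Longrightarrow> p i > 0"
    and psum: "(\<Sum>i\<in>{1..k}. p i) = 1"
    and sing: "\<And>i. i \<in> Asing \<Longrightarrow> rank (A i) = 1"
    and inv: "\<And>i. i \<in> Ainv \<Longrightarrow> invertible (A i)"
    and eta_prob: "prob_space \<eta>"
    and eta_stat: "stationary P1M (Qop k p A) \<eta>"
  shows "stationary (AP1M k) (Qbar k p A) (pmeas k p \<Otimes>\<^sub>M \<eta>)
    \<and> (\<exists>c>0. \<exists>C::real. \<forall>n::nat. \<forall>\<phi> \<in> borel_measurable (AP1M k).
          bounded (\<phi> ` space (AP1M k)) \<longrightarrow>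
          (\<forall>z \<in> space (AP1M k).
             \<bar>((Qbar k p A) ^^ n) \<phi> z - (\<integral>w. \<phi> w \<partial>(pmeas k p \<Otimes>\<^sub>M \<eta>))\<bar>
               \<le> C * exp (- c * real n) * supnorm (AP1M k) \<phi>))
    \<and> (\<forall>\<nu>. prob_space \<nu> \<and> stationary (AP1M k) (Qbar k p A) \<nu> \<longrightarrow>
          \<nu> = pmeas k p \<Otimes>\<^sub>M \<eta>)"
proof -
  interpret bernoulli_setting k p A Asing Ainv \<eta>
    by (rule bernoulli_setting.intro) (use assms in auto)
  have c: "0 < - ln q"
    using q_pos q_less_1 by simp
  have conv: "\<forall>n::nat. \<forall>\<phi> \<in> borel_measurable M. bounded (\<phi> ` space M) \<longrightarrow>
      (\<forall>z \<in> space M. \<bar>(T ^^ n) \<phi> z - (\<integral>w. \<phi> w \<partial>\<mu>)\<bar>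
         \<le> 2 / q * exp (- (- ln q) * real n) * supnorm M \<phi>)"
    using Qbar_funpow_exponential_convergence by simp
  have "\<nu> = \<mu>" if "prob_space \<nu>" "stationary M T \<nu>" for \<nu>
    using stationary_unique_of_uniform_convergence[OF that prob_space_mu sets_mu
        Qbar_preserves_bounded_measurable c conv] .
  then show ?thesis
    using stationary_mu c conv by blast
qed

end
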